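(* Let $G$ and $H$ be finite graphs with adjacency matrices $A=A_G$ and $B=A_H$. There exist an equitable partition $\pi$ of $V(G)$ and an equitable partition $\sigma$ of $V(H)$ whose symmetrized quotient graphs are isomorphic, $\widetilde{G/\pi}\simeq\widetilde{H/\sigma}$, if and only if there is a nonnegative real $|V(G)|\times|V(H)|$ matrix $M$ such that (i) both $MM^{\mathsf T}$ and $M^{\mathsf T}M$ are doubly stochastic, and (ii) $AM=MB$.
   Context: Graphs are finite, simple and undirected; $A_G$ denotes the adjacency matrix, indexed by $V(G)$. For a partition $\pi=\{C_1,\dots,C_k\}$ of $V(G)$ into nonempty cells, its characteristic matrix $P_\pi$ is the $V(G)\times k$ $0/1$ matrix whose $r$-th column is the indicator vector of $C_r$. The partition is equitable if the column space of $P_\pi$ is $A_G$-invariant (equivalently, for all $r,s$, every vertex of $C_r$ has the same number of neighbours in $C_s$). The normalized characteristic matrix is $\widetilde{P}_\pi=P_\pi(P_\pi^{\mathsf T}P_\pi)^{-1/2}$, and the symmetrized quotient $\widetilde{G/\pi}$ is the weighted undirected graph on the cells of $\pi$ with adjacency matrix $A_{\widetilde{G/\pi}}=\widetilde{P}_\pi^{\mathsf T}A_G\widetilde{P}_\pi$. $\widetilde{G/\pi}\simeq\widetilde{H/\sigma}$ means $\pi$ and $\sigma$ have the same number of cells and there is a bijection $\eta$ from the cells of $\pi$ to the cells of $\sigma$ with $(A_{\widetilde{G/\pi}})_{C,C'}=(A_{\widetilde{H/\sigma}})_{\eta(C),\eta(C')}$ for all cells $C,C'$ of $\pi$. A real matrix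 is doubly stochastic if it is square, nonnegative, and all row and column sums equal $1$. *)

theory Defs
  imports
    Complex_Main
    "HOL-Library.Disjoint_Sets"
    "Graph_Theory.Pair_Digraph"
begin

text \<open>
  A finite simple undirected graph is a \<^term>\<open>G\<close> satisfying \<^const>\<open>pair_graph\<close>: finite, loop-free, with
  a symmetric set of arcs \<^term>\<open>parcs G\<close> on the vertex set \<^term>\<open>pverts G\<close>. The empty graph is allowed.

  The index sets that occur (vertex sets, sets of cells) vary within a single statement, so an
  \<open>I \<times> J\<close> matrix is a function of which only the entries in \<open>I \<times> J\<close> matter; products
  carry the summation index set, and matrix equations are stated entrywise on the index sets.
\<close>

type_synonym ('i, 'j) rmat = "'i \<Rightarrow> 'j \<Rightarrow> real"

definition mmult :: "'k set \<Rightarrow> ('i, 'k) rmat \<Rightarrow> ('k, 'j) rmat \<Rightarrow> ('i, 'j) rmat" where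
  "mmult K X Y = (\<lambda>i j. \<Sum>k\<in>K. X i k * Y k j)"

definition mvmult :: "'k set \<Rightarrow> ('i, 'k) rmat \<Rightarrow> ('k \<Rightarrow> real) \<Rightarrow> ('i \<Rightarrow> real)" where
  "mvmult K X x = (\<lambda>i. \<Sum>k\<in>K. X i k * x k)"

definition mtranspose :: "('i, 'j) rmat \<Rightarrow> ('j, 'i) rmat" where
  "mtranspose X = (\<lambda>j i. X i j)"

definition idmat :: "('i, 'i) rmat" where
  "idmat = (\<lambda>i j. if i = j then 1 else 0)"

definition mat_eq_on :: "'i set \<Rightarrow> 'j set \<Rightarrow> ('i, 'j) rmat \<Rightarrow> ('i, 'j) rmat \<Rightarrow> bool" where
  "mat_eq_on I J X Y \<longleftrightarrow> (\<forall>i\<in>I. \<forall>j\<in>J. X i j = Y i j)"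

definition nonneg_mat_on :: "'i set \<Rightarrow> 'j set \<Rightarrow> ('i, 'j) rmat \<Rightarrow> bool" where
  "nonneg_mat_on I J X \<longleftrightarrow> (\<forall>i\<in>I. \<forall>j\<in>J. 0 \<le> X i j)"

definition doubly_stochastic_on :: "'i set \<Rightarrow> ('i, 'i) rmat \<Rightarrow> bool" where
  "doubly_stochastic_on I X \<longleftrightarrow> nonneg_mat_on I I X \<and>
     (\<forall>i\<in>I. (\<Sum>j\<in>I. X i j) = 1) \<and> (\<forall>j\<in>I. (\<Sum>i\<in>I. X i j) = 1)"

definition psd_on :: "'i set \<Rightarrow> ('i, 'i) rmat \<Rightarrow> bool" where
  "psd_on I S \<longleftrightarrow> mat_eq_on I I (mtranspose S) S \<and>
     (\<forall>x. 0 \<le> (\<Sum>i\<in>I. x i * mvmult I S x i))"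

text \<open>
  \<open>X\<^sup>-\<^sup>1\<^sup>/\<^sup>2\<close> for a positive definite \<open>I \<times> I\<close> matrix \<open>X\<close>: the positive semidefinite \<open>S\<close> with
  \<open>S\<^sup>2 X = 1\<close>. Entries outside \<open>I \<times> I\<close> are set to 0 so that \<open>S\<close> is unique as a function.
\<close>

definition minv_sqrt :: "'i set \<Rightarrow> ('i, 'i) rmat \<Rightarrow> ('i, 'i) rmat" where
  "minv_sqrt I X = (THE S. psd_on I S \<and>
     mat_eq_on I I (mmult I (mmult I S S) X) idmat \<and>
     (\<forall>i j. i \<notin> I \<or> j \<notin> I \<longrightarrow> S i j = 0))"

definition col_space :: "'i set \<Rightarrow> 'j set \<Rightarrow> ('i, 'j) rmat \<Rightarrow> ('i \<Rightarrow> real) set" where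
  "col_space I J X = {x. \<exists>c. \<forall>i\<in>I. x i = mvmult J X c i}"

definition adj_mat :: "'a pair_pre_digraph \<Rightarrow> ('a, 'a) rmat" where
  "adj_mat G = (\<lambda>u v. if (u, v) \<in> parcs G then 1 else 0)"

text \<open>The columns of the characteristic matrix of \<open>\<pi>\<close> are indexed by the cells themselves.\<close>

definition char_mat :: "('a, 'a set) rmat" where
  "char_mat = (\<lambda>v C. if v \<in> C then 1 else 0)"

definition equitable_partition :: "'a pair_pre_digraph \<Rightarrow> 'a set set \<Rightarrow> bool" where
  "equitable_partition G \<pi> \<longleftrightarrow> partition_on (pverts G) \<pi> \<and>
     (\<forall>x \<in> col_space (pverts G) \<pi> char_mat.
        mvmult (pverts G) (adj_mat G) x \<in> col_space (pverts G) \<pi> char_mat)"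

definition norm_char_mat :: "'a set \<Rightarrow> 'a set set \<Rightarrow> ('a, 'a set) rmat" where
  "norm_char_mat V \<pi> =
     mmult \<pi> char_mat (minv_sqrt \<pi> (mmult V (mtranspose char_mat) char_mat))"

definition sym_quotient :: "'a pair_pre_digraph \<Rightarrow> 'a set set \<Rightarrow> ('a set, 'a set) rmat" where
  "sym_quotient G \<pi> =
     mmult (pverts G)
       (mmult (pverts G) (mtranspose (norm_char_mat (pverts G) \<pi>)) (adj_mat G))
       (norm_char_mat (pverts G) \<pi>)"

definition weighted_iso :: "'i set \<Rightarrow> ('i, 'i) rmat \<Rightarrow> 'j set \<Rightarrow> ('j, 'j) rmat \<Rightarrow> bool" where
  "weighted_iso I X J Y \<longleftrightarrow>
     (\<exists>\<eta>. bij_betw \<eta> I J \<and> (\<forall>i\<in>I. \<forall>i'\<in>I. X i i' = Y (\<eta> i) (\<eta> i')))"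

lemma minv_sqrt_diag:
  fixes d :: "'i \<Rightarrow> real"
  assumes fin: "finite I" and pos: "\<And>i. i \<in> I \<Longrightarrow> 0 < d i"
    and X: "mat_eq_on I I X (\<lambda>i j. if i = j then d i else 0)"
  shows "minv_sqrt I X = (\<lambda>i j. if i \<in> I \<and> i = j then 1 / sqrt (d i) else 0)"
proof -
  define t where "t i = 1 / sqrt (d i)" for i
  define T where "T = (\<lambda>i j. if i \<in> I \<and> i = j then t i else 0)"
  have tpos: "0 < t i" if "i \<in> I" for i using pos[OF that] by (simp add: t_def)
  have tsq: "t i * t i = 1 / d i" if "i \<in> I" for i
    using pos[OF that] by (simp add: t_def)
  have X': "X i j = (if i = j then d i else 0)" if "i \<in> I" "j \<in> I" for i j
    using X that by (simp add: mat_eq_on_def)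
  have prodX: "mmult I Y X i j = Y i j * d j" if "j \<in> I" for Y :: "('i, 'i) rmat" and i j
  proof -
    have "mmult I Y X i j = (\<Sum>k\<in>I. if k = j then Y i k * d k else 0)"
      unfolding mmult_def by (rule sum.cong) (auto simp: X' that)
    then show ?thesis using fin that by simp
  qed
  have TT: "mmult I T T i j = (if i = j then 1 / d i else 0)" if "i \<in> I" "j \<in> I" for i j
  proof -
    have "mmult I T T i j = (\<Sum>k\<in>I. if k = i then t i * T k j else 0)"
      unfolding mmult_def by (rule sum.cong) (auto simp: T_def that)
    then show ?thesis using fin that tsq by (simp add: T_def)
  qed
  have Tv: "mvmult I T x i = t i * x i" if "i \<in> I" for x i
  proof -
    have "mvmult I T x i = (\<Sum>k\<in>I. if k = i then t i * x k else 0)"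
      unfolding mvmult_def by (rule sum.cong) (auto simp: T_def that)
    then show ?thesis using fin that by simp
  qed
  have quadT: "(\<Sum>i\<in>I. x i * mvmult I T x i) = (\<Sum>i\<in>I. t i * (x i)\<^sup>2)" for x
    by (rule sum.cong) (auto simp: Tv power2_eq_square)
  have "minv_sqrt I X = T"
    unfolding minv_sqrt_def
  proof (rule the_equality, intro conjI)
    show "psd_on I T"
      unfolding psd_on_def quadT
      by (auto simp: mat_eq_on_def mtranspose_def T_def intro!: sum_nonneg mult_nonneg_nonneg
          less_imp_le[OF tpos])
    show "mat_eq_on I I (mmult I (mmult I T T) X) idmat"
      unfolding mat_eq_on_def
    proof (intro ballI)
      fix i j assume "i \<in> I" "j \<in> I"
      then show "mmult I (mmult I T T) X i j = idmat i j"
        using pos[of j] by (cases "i = j") (simp_all add: prodX TT idmat_def)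
    qed
    show "\<forall>i j. i \<notin> I \<or> j \<notin> I \<longrightarrow> T i j = 0" by (auto simp: T_def)
  next
    fix S
    assume S: "psd_on I S \<and> mat_eq_on I I (mmult I (mmult I S S) X) idmat \<and>
      (\<forall>i j. i \<notin> I \<or> j \<notin> I \<longrightarrow> S i j = 0)"
    have SS: "mmult I S S i j = (if i = j then 1 / d i else 0)" if "i \<in> I" "j \<in> I" for i j
    proof -
      have "mmult I S S i j * d j = (if i = j then 1 else 0)"
        using S that by (auto simp: mat_eq_on_def prodX idmat_def)
      then show ?thesis using pos[OF that(2)] by (auto simp: field_simps split: if_splits)
    qed
    have comm: "S i j * t j = t i * S i j" if ij: "i \<in> I" "j \<in> I" for i j
    proof -
      have "mmult I S (mmult I S S) i j = (\<Sum>k\<in>I. if k = j then S i k / d k else 0)"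
        unfolding mmult_def[of I S "mmult I S S"] by (rule sum.cong) (auto simp: SS ij)
      then have l: "mmult I S (mmult I S S) i j = S i j / d j" using fin ij by simp
      have "mmult I (mmult I S S) S i j = (\<Sum>k\<in>I. if k = i then S k j / d i else 0)"
        unfolding mmult_def[of I "mmult I S S" S] by (rule sum.cong) (auto simp: SS ij)
      then have r: "mmult I (mmult I S S) S i j = S i j / d i" using fin ij by simp
      have "mmult I S (mmult I S S) i j = (\<Sum>k\<in>I. \<Sum>l\<in>I. S i k * S k l * S l j)"
        by (simp add: mmult_def sum_distrib_left mult.assoc)
      also have "\<dots> = (\<Sum>l\<in>I. \<Sum>k\<in>I. S i k * S k l * S l j)" by (rule sum.swap)
      also have "\<dots> = mmult I (mmult I S S) S i j"
        by (simp add: mmult_def sum_distrib_right)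
      finally have "S i j / d j = S i j / d i" using l r by simp
      then have "S i j = 0 \<or> d i = d j" using pos ij by (auto simp: field_simps)
      then show ?thesis by (auto simp: t_def)
    qed
    have eq: "S i j = T i j" if ij: "i \<in> I" "j \<in> I" for i j
    proof -
      define y where "y k = S k j - T k j" for k
      have Ty: "mvmult I S y k + mvmult I T y k = 0" if k: "k \<in> I" for k
      proof -
        have "(\<Sum>l\<in>I. S k l * T l j) = (\<Sum>l\<in>I. if l = j then S k l * t l else 0)"
          by (rule sum.cong) (auto simp: T_def)
        then have "(\<Sum>l\<in>I. S k l * T l j) = S k j * t j" using fin ij by simp
        then have "mvmult I S y k = mmult I S S k j - S k j * t j"
          by (simp add: mvmult_def y_def mmult_def right_diff_distrib sum_subtractf)
        moreover have "mvmult I T y k = t k * S k j - t k * T k j"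
          using k by (simp add: Tv y_def right_diff_distrib)
        ultimately show ?thesis
          using SS[OF k ij(2)] comm[OF k ij(2)] tsq[OF k] k by (auto simp: T_def)
      qed
      have "(\<Sum>k\<in>I. y k * mvmult I S y k) + (\<Sum>k\<in>I. y k * mvmult I T y k)
          = (\<Sum>k\<in>I. y k * (mvmult I S y k + mvmult I T y k))"
        by (simp add: sum.distrib distrib_left)
      also have "\<dots> = 0" using Ty by simp
      finally have "(\<Sum>k\<in>I. t k * (y k)\<^sup>2) = - (\<Sum>k\<in>I. y k * mvmult I S y k)"
        unfolding quadT by simp
      also have "\<dots> \<le> 0" using S by (simp add: psd_on_def)
      finally have le: "(\<Sum>k\<in>I. t k * (y k)\<^sup>2) \<le> 0" .
      have nn: "0 \<le> t k * (y k)\<^sup>2" if "k \<in> I" for k using tpos[OF that] by simp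
      have "(\<Sum>k\<in>I. t k * (y k)\<^sup>2) = 0"
        using le sum_nonneg[of I "\<lambda>k. t k * (y k)\<^sup>2"] nn by force
      then have "t i * (y i)\<^sup>2 = 0" using sum_nonneg_eq_0_iff[OF fin, of "\<lambda>k. t k * (y k)\<^sup>2"] nn ij by auto
      then have "y i = 0" using tpos[OF ij(1)] by simp
      then show ?thesis by (simp add: y_def)
    qed
    show "S = T"
    proof (intro ext)
      fix i j show "S i j = T i j"
        using eq[of i j] S by (cases "i \<in> I \<and> j \<in> I") (auto simp: T_def)
    qed
  qed
  then show ?thesis unfolding T_def t_def .
qed

lemma char_mat_gram:
  assumes "finite V" and "partition_on V \<pi>"
  shows "mat_eq_on \<pi> \<pi> (mmult V (mtranspose char_mat) char_mat)
     (\<lambda>C D. if C = D then real (card C) else 0)"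
  unfolding mat_eq_on_def
proof (intro ballI)
  fix C D assume CD: "C \<in> \<pi>" "D \<in> \<pi>"
  have sub: "C \<subseteq> V" using CD assms(2) by (auto simp: partition_on_def)
  have "mmult V (mtranspose char_mat) char_mat C D = (\<Sum>v\<in>V. if v \<in> C \<inter> D then 1 else 0)"
    unfolding mmult_def mtranspose_def char_mat_def by (rule sum.cong) auto
  also have "\<dots> = real (card (V \<inter> (C \<inter> D)))"
    unfolding sum.inter_restrict[OF assms(1), symmetric] by simp
  also have "V \<inter> (C \<inter> D) = (if C = D then C else {})"
    using CD assms(2) sub by (auto simp: partition_on_def disjoint_def)
  finally show "mmult V (mtranspose char_mat) char_mat C D = (if C = D then real (card C) else 0)"
    by simp
qed

lemma norm_char_mat_eq:
  assumes V: "finite V" and p: "partition_on V \<pi>" and C: "C \<in> \<pi>"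
  shows "norm_char_mat V \<pi> v C = (if v \<in> C then 1 / sqrt (card C) else 0)"
proof -
  have fin: "finite \<pi>" using finite_elements[OF V p] .
  have cpos: "0 < real (card C)" if "C \<in> \<pi>" for C
  proof -
    have "C \<subseteq> V" "C \<noteq> {}" using that p by (auto simp: partition_on_def)
    then show ?thesis using V by (simp add: card_gt_0_iff finite_subset)
  qed
  have S: "minv_sqrt \<pi> (mmult V (mtranspose char_mat) char_mat)
      = (\<lambda>C D. if C \<in> \<pi> \<and> C = D then 1 / sqrt (card C) else 0)"
    by (rule minv_sqrt_diag[OF fin cpos char_mat_gram[OF V p]])
  have "norm_char_mat V \<pi> v C =
      (\<Sum>D\<in>\<pi>. if D = C then char_mat v D * (1 / sqrt (card D)) else 0)"
    unfolding norm_char_mat_def S mmult_def[of \<pi>]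
    by (rule sum.cong) auto
  then show ?thesis using fin C by (simp add: char_mat_def)
qed

lemma equitable_partition_iff_card:
  assumes "pair_graph G"
  shows "equitable_partition G \<pi> \<longleftrightarrow> partition_on (pverts G) \<pi> \<and>
    (\<forall>C\<in>\<pi>. \<forall>D\<in>\<pi>. \<forall>u\<in>C. \<forall>v\<in>C.
       card {w\<in>D. (u, w) \<in> parcs G} = card {w\<in>D. (v, w) \<in> parcs G})"
proof (cases "partition_on (pverts G) \<pi>")
  case True
  note p = this
  let ?V = "pverts G"
  interpret pair_graph G by fact
  have V: "finite ?V" by (rule pair_finite_verts)
  have fin: "finite \<pi>" using finite_elements[OF V p] .
  have sub: "C \<subseteq> ?V" if "C \<in> \<pi>" for C using that p by (auto simp: partition_on_def)
  have P: "mvmult \<pi> char_mat c v = c C" if "C \<in> \<pi>" "v \<in> C" for c v C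
  proof -
    have "mvmult \<pi> char_mat c v = (\<Sum>D\<in>\<pi>. if D = C then c D else 0)"
      unfolding mvmult_def char_mat_def
      by (rule sum.cong) (use that p in \<open>auto simp: partition_on_def disjoint_def\<close>)
    then show ?thesis using fin that by simp
  qed
  have cs: "x \<in> col_space ?V \<pi> char_mat \<longleftrightarrow> (\<forall>C\<in>\<pi>. \<forall>u\<in>C. \<forall>v\<in>C. x u = x v)" for x
  proof
    assume "x \<in> col_space ?V \<pi> char_mat"
    then obtain c where c: "\<And>i. i \<in> ?V \<Longrightarrow> x i = mvmult \<pi> char_mat c i"
      by (auto simp: col_space_def)
    have "x u = c C" if "C \<in> \<pi>" "u \<in> C" for u C
      using c[of u] P[OF that] sub[OF that(1)] that by auto
    then show "\<forall>C\<in>\<pi>. \<forall>u\<in>C. \<forall>v\<in>C. x u = x v" by simp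
  next
    assume h: "\<forall>C\<in>\<pi>. \<forall>u\<in>C. \<forall>v\<in>C. x u = x v"
    have "x i = mvmult \<pi> char_mat (\<lambda>C. x (SOME v. v \<in> C)) i" if "i \<in> ?V" for i
    proof -
      have "i \<in> \<Union>\<pi>" using that unfolding partition_onD1[OF p] .
      then obtain C where C: "C \<in> \<pi>" "i \<in> C" by blast
      have "(SOME v. v \<in> C) \<in> C" using C(2) by (rule someI)
      then show ?thesis unfolding P[OF C] using h C by blast
    qed
    then show "x \<in> col_space ?V \<pi> char_mat" unfolding col_space_def by blast
  qed
  have ind: "mvmult ?V (adj_mat G) (\<lambda>v. char_mat v D) u = card {w\<in>D. (u, w) \<in> parcs G}"
    if "D \<in> \<pi>" for D u
  proof -
    have "mvmult ?V (adj_mat G) (\<lambda>v. char_mat v D) u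
        = (\<Sum>w\<in>?V. if w \<in> {w\<in>D. (u, w) \<in> parcs G} then 1 else 0)"
      unfolding mvmult_def adj_mat_def char_mat_def by (rule sum.cong) auto
    also have "\<dots> = real (card (?V \<inter> {w\<in>D. (u, w) \<in> parcs G}))"
      unfolding sum.inter_restrict[OF V, symmetric] by simp
    also have "?V \<inter> {w\<in>D. (u, w) \<in> parcs G} = {w\<in>D. (u, w) \<in> parcs G}"
      using sub[OF that] by auto
    finally show ?thesis .
  qed
  show ?thesis
  proof
    assume eq: "equitable_partition G \<pi>"
    have "card {w\<in>D. (u, w) \<in> parcs G} = card {w\<in>D. (v, w) \<in> parcs G}"
      if "C \<in> \<pi>" "D \<in> \<pi>" "u \<in> C" "v \<in> C" for C D u v
    proof -
      have "(\<lambda>v. char_mat v D) \<in> col_space ?V \<pi> char_mat"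
        unfolding cs using p that(2) by (auto simp: char_mat_def partition_on_def disjoint_def)
      then have "mvmult ?V (adj_mat G) (\<lambda>v. char_mat v D) \<in> col_space ?V \<pi> char_mat"
        using eq by (auto simp: equitable_partition_def)
      then have "mvmult ?V (adj_mat G) (\<lambda>v. char_mat v D) u
          = mvmult ?V (adj_mat G) (\<lambda>v. char_mat v D) v"
        unfolding cs using that by blast
      then show ?thesis by (simp add: ind that)
    qed
    then show "partition_on ?V \<pi> \<and> (\<forall>C\<in>\<pi>. \<forall>D\<in>\<pi>. \<forall>u\<in>C. \<forall>v\<in>C.
       card {w\<in>D. (u, w) \<in> parcs G} = card {w\<in>D. (v, w) \<in> parcs G})"
      using p by blast
  next
    assume h: "partition_on ?V \<pi> \<and> (\<forall>C\<in>\<pi>. \<forall>D\<in>\<pi>. \<forall>u\<in>C. \<forall>v\<in>C.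
       card {w\<in>D. (u, w) \<in> parcs G} = card {w\<in>D. (v, w) \<in> parcs G})"
    show "equitable_partition G \<pi>"
      unfolding equitable_partition_def
    proof (intro conjI ballI p)
      fix x assume "x \<in> col_space ?V \<pi> char_mat"
      then obtain c where c: "\<And>i. i \<in> ?V \<Longrightarrow> x i = mvmult \<pi> char_mat c i"
        by (auto simp: col_space_def)
      have "mvmult ?V (adj_mat G) x u
          = (\<Sum>D\<in>\<pi>. real (card {w\<in>D. (u, w) \<in> parcs G}) * c D)" for u
      proof -
        have "mvmult ?V (adj_mat G) x u
            = (\<Sum>w\<in>?V. \<Sum>D\<in>\<pi>. adj_mat G u w * char_mat w D * c D)"
          unfolding mvmult_def[of ?V]
          by (rule sum.cong) (simp_all add: c mvmult_def sum_distrib_left mult.assoc)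
        also have "\<dots> = (\<Sum>D\<in>\<pi>. \<Sum>w\<in>?V. adj_mat G u w * char_mat w D * c D)"
          by (rule sum.swap)
        also have "\<dots> = (\<Sum>D\<in>\<pi>. mvmult ?V (adj_mat G) (\<lambda>v. char_mat v D) u * c D)"
          by (simp add: mvmult_def sum_distrib_right)
        also have "\<dots> = (\<Sum>D\<in>\<pi>. real (card {w\<in>D. (u, w) \<in> parcs G}) * c D)"
          by (rule sum.cong) (simp_all add: ind)
        finally show ?thesis .
      qed
      note Ax = this
      show "mvmult ?V (adj_mat G) x \<in> col_space ?V \<pi> char_mat"
        unfolding cs
      proof (intro ballI)
        fix C u v assume C: "C \<in> \<pi>" "u \<in> C" "v \<in> C"
        have "card {w\<in>D. (u, w) \<in> parcs G} = card {w\<in>D. (v, w) \<in> parcs G}" if "D \<in> \<pi>" for D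
          using h C that by blast
        then show "mvmult ?V (adj_mat G) x u = mvmult ?V (adj_mat G) x v"
          unfolding Ax by (intro sum.cong) simp_all
      qed
    qed
  qed
qed (simp add: equitable_partition_def)

end

theory Submission
  imports Defs
begin

text \<open>
  If the quotients are isomorphic via \<open>\<eta>\<close>, take \<open>M = P\<^sub>\<pi> N P\<^sub>\<sigma>\<^sup>T\<close> with the normalized characteristic
  matrices and the permutation matrix \<open>N\<close> of \<open>\<eta>\<close>: it is constant on each \<open>C \<times> \<eta> C\<close> and zero elsewhere.

  Conversely, let \<open>\<pi>\<close> and \<open>\<sigma>\<close> consist of the traces on \<open>V(G)\<close> and \<open>V(H)\<close> of the components of the bipartite
  support graph of \<open>M\<close>. The fixed vectors of \<open>S = M M\<^sup>T\<close> are exactly those constant on the cells of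
  \<open>\<pi>\<close>, and \<open>A\<close> commutes with \<open>S\<close>, so \<open>\<pi>\<close> is equitable. Row sums of \<open>M\<close> form a fixed vector, so they take a
  constant value \<open>r\<^sub>C\<close> on a cell \<open>C\<close>; column sums are then \<open>1 / r\<^sub>C\<close> on the neighbouring cell
  \<open>D\<close>, and double counting gives \<open>|D| = r\<^sub>C\<^sup>2 |C|\<close>. Applying \<open>M\<^sup>T A = B M\<^sup>T\<close> to indicators of cells turns
  this into the equality of the quotient matrices.
\<close>

section \<open>Adjacency row sums and entries of the symmetrized quotient\<close>

lemma mtranspose_mtranspose [simp]: "mtranspose (mtranspose X) = X"
  by (simp add: mtranspose_def)

lemma adj_mat_commute:
  assumes "pair_graph G"
  shows "adj_mat G u v = adj_mat G v u"
proof -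
  interpret pair_graph G by fact
  show ?thesis
    using arcs_symmetric by (auto simp: adj_mat_def)
qed

lemma sum_adj_mat:
  assumes "finite D"
  shows "(\<Sum>w\<in>D. adj_mat G u w) = real (card {w \<in> D. (u, w) \<in> parcs G})"
  using assms by (simp add: adj_mat_def sum.If_cases Int_def conj_commute)

lemma partition_on_cellD:
  assumes "finite V" and "partition_on V \<pi>" and "C \<in> \<pi>"
  shows "C \<subseteq> V" and "finite C" and "0 < real (card C)"
proof -
  show "C \<subseteq> V" using assms(2,3) by (auto simp: partition_on_def)
  then show "finite C" using assms(1) finite_subset by blast
  moreover have "C \<noteq> {}" using assms(2,3) by (auto simp: partition_on_def)
  ultimately show "0 < real (card C)" by (simp add: card_gt_0_iff)
qed

lemma partition_on_cell_unique:
  assumes "partition_on V \<pi>" and "C \<in> \<pi>" and "D \<in> \<pi>" and "v \<in> C" and "v \<in> D"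
  shows "C = D"
  using assms by (auto simp: partition_on_def disjoint_def)

text \<open>Neighbour counts become row sums of \<open>adj_mat\<close> over a cell, the form in
  which the matrix identities below apply.\<close>

lemma equitable_partition_iff_sum:
  assumes "pair_graph G"
  shows "equitable_partition G \<pi> \<longleftrightarrow> partition_on (pverts G) \<pi> \<and>
    (\<forall>C\<in>\<pi>. \<forall>D\<in>\<pi>. \<forall>u\<in>C. \<forall>v\<in>C. (\<Sum>w\<in>D. adj_mat G u w) = (\<Sum>w\<in>D. adj_mat G v w))"
proof (cases "partition_on (pverts G) \<pi>")
  case True
  interpret pair_graph G by fact
  have "finite D" if "D \<in> \<pi>" for D
    using partition_on_cellD(2)[OF pair_finite_verts True that] .
  then show ?thesis
    unfolding equitable_partition_iff_card[OF assms] by (simp add: sum_adj_mat)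
qed (simp add: equitable_partition_def)

text \<open>Column \<open>C\<close> of the normalized characteristic matrix is the indicator of
  \<open>C\<close> divided by \<open>sqrt (card C)\<close>, so the triple product collapses to a
  block sum of the adjacency matrix.\<close>

lemma sym_quotient_eq_sum:
  assumes V: "finite (pverts G)" and p: "partition_on (pverts G) \<pi>"
    and C: "C \<in> \<pi>" and D: "D \<in> \<pi>"
  shows "sym_quotient G \<pi> C D =
    (\<Sum>u\<in>C. \<Sum>w\<in>D. adj_mat G u w) / (sqrt (card C) * sqrt (card D))"
proof -
  let ?V = "pverts G"
  note cell = partition_on_cellD[OF V p]
  have restrict: "(\<Sum>v\<in>?V. norm_char_mat ?V \<pi> v X * f v) = (\<Sum>v\<in>X. f v) / sqrt (card X)"
    if "X \<in> \<pi>" for X and f :: "'a \<Rightarrow> real"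
  proof -
    have "(\<Sum>v\<in>?V. norm_char_mat ?V \<pi> v X * f v) = (\<Sum>v\<in>X. norm_char_mat ?V \<pi> v X * f v)"
      by (rule sum.mono_neutral_right)
        (use V cell(1)[OF that] in \<open>auto simp: norm_char_mat_eq[OF V p that]\<close>)
    then show ?thesis
      by (simp add: norm_char_mat_eq[OF V p that] sum_divide_distrib)
  qed
  have "sym_quotient G \<pi> C D = (\<Sum>w\<in>?V. norm_char_mat ?V \<pi> w D *
      (\<Sum>u\<in>?V. norm_char_mat ?V \<pi> u C * adj_mat G u w))"
    by (simp add: sym_quotient_def mmult_def mtranspose_def mult.commute)
  also have "\<dots> = (\<Sum>w\<in>D. \<Sum>u\<in>C. adj_mat G u w) / (sqrt (card C) * sqrt (card D))"
    by (simp add: restrict C D sum_divide_distrib)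
  also have "(\<Sum>w\<in>D. \<Sum>u\<in>C. adj_mat G u w) = (\<Sum>u\<in>C. \<Sum>w\<in>D. adj_mat G u w)"
    by (rule sum.swap)
  finally show ?thesis .
qed

text \<open>In an equitable partition all \<open>card C\<close> rows of the block have the same sum,
  so the block sum is \<open>card C\<close> times the sum of any one row.\<close>

lemma sym_quotient_equitable:
  assumes G: "pair_graph G" and eq: "equitable_partition G \<pi>"
    and C: "C \<in> \<pi>" and D: "D \<in> \<pi>" and u: "u \<in> C"
  shows "sym_quotient G \<pi> C D = sqrt (card C) / sqrt (card D) * (\<Sum>w\<in>D. adj_mat G u w)"
proof -
  interpret pair_graph G by fact
  have p: "partition_on (pverts G) \<pi>" using eq by (simp add: equitable_partition_def)
  have "(\<Sum>v\<in>C. \<Sum>w\<in>D. adj_mat G v w) = (\<Sum>v\<in>C. \<Sum>w\<in>D. adj_mat G u w)"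
  proof (rule sum.cong)
    fix v assume "v \<in> C"
    then show "(\<Sum>w\<in>D. adj_mat G v w) = (\<Sum>w\<in>D. adj_mat G u w)"
      using eq C D u unfolding equitable_partition_iff_sum[OF G] by blast
  qed simp
  then show ?thesis
    using partition_on_cellD(3)[OF pair_finite_verts p C]
      partition_on_cellD(3)[OF pair_finite_verts p D]
    by (simp add: sym_quotient_eq_sum[OF pair_finite_verts p C D] field_simps real_sqrt_mult)
qed

lemma sym_quotient_commute:
  assumes G: "pair_graph G" and p: "partition_on (pverts G) \<pi>"
    and C: "C \<in> \<pi>" and D: "D \<in> \<pi>"
  shows "sym_quotient G \<pi> C D = sym_quotient G \<pi> D C"
proof -
  interpret pair_graph G by fact
  have "(\<Sum>u\<in>C. \<Sum>w\<in>D. adj_mat G u w) = (\<Sum>u\<in>D. \<Sum>w\<in>C. adj_mat G u w)"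
    by (subst sum.swap) (simp add: adj_mat_commute[OF G])
  then show ?thesis
    by (simp add: sym_quotient_eq_sum[OF pair_finite_verts p] C D mult.commute)
qed

section \<open>Doubly stochastic Gram matrices\<close>

text \<open>A Gram matrix of a nonnegative matrix is symmetric and nonnegative, so only its row sums
  remain to be tested; exchanging summations puts them in the stated form.\<close>

lemma doubly_stochastic_on_mmult_mtranspose_iff:
  assumes "nonneg_mat_on I J M"
  shows "doubly_stochastic_on I (mmult J M (mtranspose M)) \<longleftrightarrow>
    (\<forall>i\<in>I. (\<Sum>j\<in>J. M i j * (\<Sum>i'\<in>I. M i' j)) = 1)"
proof -
  have nn: "nonneg_mat_on I I (mmult J M (mtranspose M))"
    using assms unfolding nonneg_mat_on_def mmult_def mtranspose_def
    by (auto intro!: sum_nonneg)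
  have row: "(\<Sum>i'\<in>I. mmult J M (mtranspose M) i i') = (\<Sum>j\<in>J. M i j * (\<Sum>i'\<in>I. M i' j))" for i
    unfolding mmult_def mtranspose_def by (subst sum.swap) (simp add: sum_distrib_left)
  have "mmult J M (mtranspose M) i i' = mmult J M (mtranspose M) i' i" for i i'
    by (simp add: mmult_def mtranspose_def mult.commute)
  then have col: "(\<Sum>i'\<in>I. mmult J M (mtranspose M) i' i) = (\<Sum>j\<in>J. M i j * (\<Sum>i'\<in>I. M i' j))" for i
    unfolding row[symmetric] by simp
  show ?thesis
    unfolding doubly_stochastic_on_def row col using nn by blast
qed

lemma doubly_stochastic_on_mtranspose_mmult_iff:
  assumes "nonneg_mat_on I J M"
  shows "doubly_stochastic_on J (mmult I (mtranspose M) M) \<longleftrightarrow>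
    (\<forall>j\<in>J. (\<Sum>i\<in>I. M i j * (\<Sum>j'\<in>J. M i j')) = 1)"
proof -
  have "nonneg_mat_on J I (mtranspose M)"
    using assms by (simp add: nonneg_mat_on_def mtranspose_def)
  from doubly_stochastic_on_mmult_mtranspose_iff[OF this] show ?thesis
    by (simp add: mtranspose_def)
qed

section \<open>From isomorphic quotients to the matrix\<close>

lemma matrix_of_quotient_iso:
  fixes G :: "'a pair_pre_digraph" and H :: "'b pair_pre_digraph"
  assumes G: "pair_graph G" and H: "pair_graph H"
    and pi: "equitable_partition G \<pi>" and sigma: "equitable_partition H \<sigma>"
    and iso: "weighted_iso \<pi> (sym_quotient G \<pi>) \<sigma> (sym_quotient H \<sigma>)"
  shows "\<exists>M :: ('a, 'b) rmat.
    nonneg_mat_on (pverts G) (pverts H) M \<and>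
    doubly_stochastic_on (pverts G) (mmult (pverts H) M (mtranspose M)) \<and>
    doubly_stochastic_on (pverts H) (mmult (pverts G) (mtranspose M) M) \<and>
    mat_eq_on (pverts G) (pverts H)
      (mmult (pverts G) (adj_mat G) M) (mmult (pverts H) M (adj_mat H))"
proof -
  let ?V = "pverts G" and ?W = "pverts H"
  have V: "finite ?V" and W: "finite ?W"
    using G H by (auto simp: pair_graph_def pair_digraph_def pair_fin_digraph.pair_finite_verts)
  have p: "partition_on ?V \<pi>" and s: "partition_on ?W \<sigma>"
    using pi sigma by (auto simp: equitable_partition_def)
  obtain \<eta> where bij: "bij_betw \<eta> \<pi> \<sigma>"
    and quot: "\<And>C D. C \<in> \<pi> \<Longrightarrow> D \<in> \<pi> \<Longrightarrow>
      sym_quotient G \<pi> C D = sym_quotient H \<sigma> (\<eta> C) (\<eta> D)"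
    using iso unfolding weighted_iso_def by blast
  have eta: "\<eta> C \<in> \<sigma>" if "C \<in> \<pi>" for C
    using bij that by (auto simp: bij_betw_def)
  \<comment> \<open>The value on the block of \<open>C\<close>: the product of the nonzero entries
    of the two normalized characteristic columns for \<open>C\<close> and
    \<open>\<eta> C\<close>.\<close>
  define m where "m C = 1 / (sqrt (card C) * sqrt (card (\<eta> C)))" for C
  \<comment> \<open>Cells are disjoint, so at most one summand is nonzero; summing over all cells
    avoids choosing the cell of a vertex.\<close>
  define M :: "('a, 'b) rmat" where
    "M u v = (\<Sum>C\<in>\<pi>. if u \<in> C \<and> v \<in> \<eta> C then m C else 0)" for u v
  note cellG = partition_on_cellD[OF V p] and cellH = partition_on_cellD[OF W s]
  have fin: "finite \<pi>" using finite_elements[OF V p] .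
  have one: "(\<Sum>D\<in>\<pi>. if P D then m D else 0) = (if P C then m C else 0)"
    if "C \<in> \<pi>" "\<And>D. D \<in> \<pi> \<Longrightarrow> P D \<Longrightarrow> D = C" for C P
  proof -
    have "(\<Sum>D\<in>\<pi>. if P D then m D else 0) = (\<Sum>D\<in>\<pi>. if D = C then (if P C then m C else 0) else 0)"
    proof (rule sum.cong)
      fix D assume "D \<in> \<pi>"
      then show "(if P D then m D else 0) = (if D = C then (if P C then m C else 0) else 0)"
        using that(2)[of D] by (cases "D = C") auto
    qed simp
    then show ?thesis using fin that(1) by simp
  qed
  have Mrow: "M u v = (if v \<in> \<eta> C then m C else 0)" if C: "C \<in> \<pi>" "u \<in> C" for u v C
  proof -
    have "D = C" if "D \<in> \<pi>" "u \<in> D \<and> v \<in> \<eta> D" for D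
      using partition_on_cell_unique[OF p that(1) C(1) _ C(2)] that(2) by blast
    then show ?thesis
      unfolding M_def using one[OF C(1), of "\<lambda>D. u \<in> D \<and> v \<in> \<eta> D"] C(2) by simp
  qed
  have Mcol: "M u v = (if u \<in> C then m C else 0)" if C: "C \<in> \<pi>" "v \<in> \<eta> C" for u v C
  proof -
    have "D = C" if "D \<in> \<pi>" "u \<in> D \<and> v \<in> \<eta> D" for D
    proof -
      \<comment> \<open>The vertex \<open>v\<close> determines only the image cell; injectivity of
        \<open>\<eta>\<close> then recovers the cell itself.\<close>
      have "\<eta> D = \<eta> C"
        using partition_on_cell_unique[OF s eta[OF that(1)] eta[OF C(1)] _ C(2)] that(2) by blast
      then show ?thesis using inj_onD[OF bij_betw_imp_inj_on[OF bij]] that(1) C(1) by blast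
    qed
    then show ?thesis
      unfolding M_def using one[OF C(1), of "\<lambda>D. u \<in> D \<and> v \<in> \<eta> D"] C(2) by simp
  qed
  have sum_row: "(\<Sum>v\<in>?W. M u v * f v) = m C * (\<Sum>v\<in>\<eta> C. f v)"
    if "C \<in> \<pi>" "u \<in> C" for u C f
  proof -
    have "(\<Sum>v\<in>?W. M u v * f v) = (\<Sum>v\<in>\<eta> C. M u v * f v)"
      by (rule sum.mono_neutral_right)
        (use W cellH(1)[OF eta] that in \<open>auto simp: Mrow[OF that]\<close>)
    then show ?thesis by (simp add: Mrow[OF that] sum_distrib_left)
  qed
  have sum_col: "(\<Sum>u\<in>?V. M u v * f u) = m C * (\<Sum>u\<in>C. f u)"
    if "C \<in> \<pi>" "v \<in> \<eta> C" for v C f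
  proof -
    have "(\<Sum>u\<in>?V. M u v * f u) = (\<Sum>u\<in>C. M u v * f u)"
      by (rule sum.mono_neutral_right)
        (use V cellG(1) that in \<open>auto simp: Mcol[OF that]\<close>)
    then show ?thesis by (simp add: Mcol[OF that] sum_distrib_left)
  qed
  have rowG: "\<exists>C\<in>\<pi>. u \<in> C" if "u \<in> ?V" for u
    using that partition_onD1[OF p] by blast
  have rowH: "\<exists>C\<in>\<pi>. v \<in> \<eta> C" if "v \<in> ?W" for v
    using that partition_onD1[OF s] bij by (auto simp: bij_betw_def)
  \<comment> \<open>Both doubly stochastic conditions reduce to this normalization.\<close>
  have mm: "m C * m C * (card C * card (\<eta> C)) = 1" if "C \<in> \<pi>" for C
    using cellG(3)[OF that] cellH(3)[OF eta[OF that]] by (simp add: m_def field_simps)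
  have rs: "(\<Sum>v\<in>?W. M u v) = m C * card (\<eta> C)" if "C \<in> \<pi>" "u \<in> C" for u C
    using sum_row[OF that, of "\<lambda>_. 1"] by simp
  have cs: "(\<Sum>u\<in>?V. M u v) = m C * card C" if "C \<in> \<pi>" "v \<in> \<eta> C" for v C
    using sum_col[OF that, of "\<lambda>_. 1"] by simp
  have nn: "nonneg_mat_on ?V ?W M"
    unfolding nonneg_mat_on_def M_def m_def by (auto intro!: sum_nonneg)
  moreover have "doubly_stochastic_on ?V (mmult ?W M (mtranspose M))"
    unfolding doubly_stochastic_on_mmult_mtranspose_iff[OF nn]
  proof
    fix u assume "u \<in> ?V"
    then obtain C where C: "C \<in> \<pi>" "u \<in> C" using rowG by blast
    show "(\<Sum>v\<in>?W. M u v * (\<Sum>u'\<in>?V. M u' v)) = 1"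
      using mm[OF C(1)] by (simp add: sum_row[OF C] cs[OF C(1)] mult_ac)
  qed
  moreover have "doubly_stochastic_on ?W (mmult ?V (mtranspose M) M)"
    unfolding doubly_stochastic_on_mtranspose_mmult_iff[OF nn]
  proof
    fix v assume "v \<in> ?W"
    then obtain C where C: "C \<in> \<pi>" "v \<in> \<eta> C" using rowH by blast
    show "(\<Sum>u\<in>?V. M u v * (\<Sum>v'\<in>?W. M u v')) = 1"
      using mm[OF C(1)] by (simp add: sum_col[OF C] rs[OF C(1)] mult_ac)
  qed
  moreover have "mat_eq_on ?V ?W (mmult ?V (adj_mat G) M) (mmult ?W M (adj_mat H))"
    unfolding mat_eq_on_def
  proof (intro ballI)
    fix u v assume "u \<in> ?V" "v \<in> ?W"
    then obtain C D where C: "C \<in> \<pi>" "u \<in> C" and D: "D \<in> \<pi>" "v \<in> \<eta> D"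
      using rowG rowH by blast
    note pos = cellG(3)[OF C(1)] cellG(3)[OF D(1)] cellH(3)[OF eta[OF C(1)]] cellH(3)[OF eta[OF D(1)]]
    \<comment> \<open>The entries of \<open>AM\<close> and \<open>MB\<close> at
      \<open>(u, v)\<close> are both reduced to a quotient entry divided by
      \<open>sqrt (card C) * sqrt (card (\<eta> D))\<close>.\<close>
    have "mmult ?V (adj_mat G) M u v = m D * (\<Sum>w\<in>D. adj_mat G u w)"
      unfolding mmult_def using sum_col[OF D, of "adj_mat G u"] by (simp add: mult.commute)
    also have "\<dots> = sym_quotient G \<pi> C D / (sqrt (card C) * sqrt (card (\<eta> D)))"
      unfolding sym_quotient_equitable[OF G pi C(1) D(1) C(2)] m_def
      using pos by (simp add: field_simps)
    \<comment> \<open>The arguments are swapped so that the row sum in \<open>H\<close> can be taken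
      at \<open>v\<close>, which lies in \<open>\<eta> D\<close>.\<close>
    also have "sym_quotient G \<pi> C D = sym_quotient H \<sigma> (\<eta> D) (\<eta> C)"
      using quot[OF C(1) D(1)] sym_quotient_commute[OF H s eta[OF C(1)] eta[OF D(1)]] by simp
    also have "\<dots> / (sqrt (card C) * sqrt (card (\<eta> D))) = m C * (\<Sum>w\<in>\<eta> C. adj_mat H v w)"
      unfolding sym_quotient_equitable[OF H sigma eta[OF D(1)] eta[OF C(1)] D(2)] m_def
      using pos by (simp add: field_simps)
    also have "\<dots> = mmult ?W M (adj_mat H) u v"
      unfolding mmult_def using sum_row[OF C, of "adj_mat H v"] by (simp add: adj_mat_commute[OF H])
    finally show "mmult ?V (adj_mat G) M u v = mmult ?W M (adj_mat H) u v" .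
  qed
  ultimately show ?thesis by blast
qed

section \<open>Fixed vectors of the Gram matrix\<close>

text \<open>The last two assumptions say that \<open>M M\<^sup>T\<close> and
  \<open>M\<^sup>T M\<close> are doubly stochastic, in the reduced form obtained above.\<close>

locale bistochastic_gram =
  fixes I :: "'i set" and J :: "'j set" and M :: "('i, 'j) rmat"
  assumes finite_rows: "finite I" and finite_cols: "finite J"
    and nonneg: "i \<in> I \<Longrightarrow> j \<in> J \<Longrightarrow> 0 \<le> M i j"
    and row_sums: "i \<in> I \<Longrightarrow> (\<Sum>j\<in>J. M i j * (\<Sum>i'\<in>I. M i' j)) = 1"
    and col_sums: "j \<in> J \<Longrightarrow> (\<Sum>i\<in>I. M i j * (\<Sum>j'\<in>J. M i j')) = 1"
begin

definition row_sum :: "'i \<Rightarrow> real" where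
  "row_sum i = (\<Sum>j\<in>J. M i j)"

text \<open>This is \<open>M M\<^sup>T f = f\<close> on \<open>I\<close>, bracketed as
  \<open>M (M\<^sup>T f)\<close>.\<close>

definition fixed_vec :: "('i \<Rightarrow> real) \<Rightarrow> bool" where
  "fixed_vec f \<longleftrightarrow> (\<forall>i\<in>I. (\<Sum>j\<in>J. M i j * (\<Sum>i'\<in>I. M i' j * f i')) = f i)"

text \<open>Linked rows are those joined by a walk of length two in the bipartite support graph,
  that is, those with a positive entry in \<open>M M\<^sup>T\<close>.\<close>

definition linked :: "'i rel" where
  "linked = {(i, i'). i \<in> I \<and> i' \<in> I \<and> (\<exists>j\<in>J. 0 < M i j \<and> 0 < M i' j)}"

definition cells :: "'i set set" where
  "cells = I // linked\<^sup>+"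

text \<open>For a cell \<open>C\<close> this is the column side of its component.\<close>

definition nbhd :: "'i set \<Rightarrow> 'j set" where
  "nbhd C = {j \<in> J. \<exists>i\<in>C. 0 < M i j}"

text \<open>A zero row would make the sum in \<open>row_sums\<close> equal to 0 instead of
  1.\<close>

lemma row_support: "i \<in> I \<Longrightarrow> \<exists>j\<in>J. 0 < M i j"
  using row_sums[of i] nonneg by (metis (no_types, lifting) le_less mult_eq_0_iff sum.neutral zero_neq_one)

lemma col_support: "j \<in> J \<Longrightarrow> \<exists>i\<in>I. 0 < M i j"
  using col_sums[of j] nonneg by (metis (no_types, lifting) le_less mult_eq_0_iff sum.neutral zero_neq_one)

text \<open>A vector \<open>f\<close> fixed by \<open>S = M M\<^sup>T\<close> satisfies \<open>\<Sum> S i i' (f i - f i')\<^sup>2 = 0\<close>.\<close>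

lemma fixed_vec_linked:
  assumes f: "fixed_vec f" and "(a, b) \<in> linked"
  shows "f a = f b"
proof -
  let ?q = "\<lambda>i i' j. M i j * M i' j * (f i - f i')\<^sup>2"
  have sq: "(\<Sum>i\<in>I. \<Sum>j\<in>J. \<Sum>i'\<in>I. M i j * M i' j * (f i)\<^sup>2) = (\<Sum>i\<in>I. (f i)\<^sup>2)"
  proof (rule sum.cong)
    fix i assume "i \<in> I"
    have "(\<Sum>j\<in>J. \<Sum>i'\<in>I. M i j * M i' j * (f i)\<^sup>2) = (\<Sum>j\<in>J. M i j * (\<Sum>i'\<in>I. M i' j)) * (f i)\<^sup>2"
      by (simp add: sum_distrib_left sum_distrib_right)
    then show "(\<Sum>j\<in>J. \<Sum>i'\<in>I. M i j * M i' j * (f i)\<^sup>2) = (f i)\<^sup>2"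
      using row_sums[OF \<open>i \<in> I\<close>] by simp
  qed simp
  have "(\<Sum>i\<in>I. \<Sum>j\<in>J. \<Sum>i'\<in>I. M i j * M i' j * (f i')\<^sup>2)
      = (\<Sum>j\<in>J. \<Sum>i\<in>I. \<Sum>i'\<in>I. M i j * M i' j * (f i')\<^sup>2)"
    by (rule sum.swap)
  \<comment> \<open>The weight \<open>M i j * M i' j\<close> is symmetric in the two row indices, so
    they may be exchanged.\<close>
  also have "\<dots> = (\<Sum>j\<in>J. \<Sum>i\<in>I. \<Sum>i'\<in>I. M i j * M i' j * (f i)\<^sup>2)"
    by (subst (2) sum.swap) (simp add: mult.commute)
  also have "\<dots> = (\<Sum>i\<in>I. \<Sum>j\<in>J. \<Sum>i'\<in>I. M i j * M i' j * (f i)\<^sup>2)"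
    by (rule sum.swap)
  finally have sq': "(\<Sum>i\<in>I. \<Sum>j\<in>J. \<Sum>i'\<in>I. M i j * M i' j * (f i')\<^sup>2) = (\<Sum>i\<in>I. (f i)\<^sup>2)"
    using sq by simp
  have cross: "(\<Sum>i\<in>I. \<Sum>j\<in>J. \<Sum>i'\<in>I. M i j * M i' j * (f i * f i')) = (\<Sum>i\<in>I. (f i)\<^sup>2)"
  proof (rule sum.cong)
    fix i assume "i \<in> I"
    have "(\<Sum>j\<in>J. \<Sum>i'\<in>I. M i j * M i' j * (f i * f i'))
        = f i * (\<Sum>j\<in>J. M i j * (\<Sum>i'\<in>I. M i' j * f i'))"
      by (simp add: sum_distrib_left mult_ac)
    then show "(\<Sum>j\<in>J. \<Sum>i'\<in>I. M i j * M i' j * (f i * f i')) = (f i)\<^sup>2"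
      using f \<open>i \<in> I\<close> by (simp add: fixed_vec_def power2_eq_square)
  qed simp
  \<comment> \<open>Expanding the square gives three sums, each equal to the squared norm of
    \<open>f\<close>, with coefficients 1, 1 and -2.\<close>
  have "(\<Sum>i\<in>I. \<Sum>j\<in>J. \<Sum>i'\<in>I. ?q i i' j)
      = (\<Sum>i\<in>I. \<Sum>j\<in>J. \<Sum>i'\<in>I. M i j * M i' j * (f i)\<^sup>2)
      + (\<Sum>i\<in>I. \<Sum>j\<in>J. \<Sum>i'\<in>I. M i j * M i' j * (f i')\<^sup>2)
      - 2 * (\<Sum>i\<in>I. \<Sum>j\<in>J. \<Sum>i'\<in>I. M i j * M i' j * (f i * f i'))"
    by (simp add: power2_diff algebra_simps sum.distrib sum_subtractf sum_distrib_left)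
  then have zero: "(\<Sum>i\<in>I. \<Sum>j\<in>J. \<Sum>i'\<in>I. ?q i i' j) = 0"
    using sq sq' cross by simp
  obtain j where j: "a \<in> I" "b \<in> I" "j \<in> J" "0 < M a j" "0 < M b j"
    using assms(2) by (auto simp: linked_def)
  have nn: "0 \<le> ?q i i' j'" if "i \<in> I" "i' \<in> I" "j' \<in> J" for i i' j'
    using nonneg that by simp
  \<comment> \<open>All terms are nonnegative, so the zero total is peeled off one summation at a
    time down to the term at \<open>a\<close>, \<open>b\<close> and the linking column.\<close>
  have "(\<Sum>j\<in>J. \<Sum>i'\<in>I. ?q a i' j) = 0"
    using zero j(1) nn by (subst (asm) sum_nonneg_eq_0_iff[OF finite_rows]) (auto intro!: sum_nonneg)
  then have "(\<Sum>i'\<in>I. ?q a i' j) = 0"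
    using j(1,3) nn by (subst (asm) sum_nonneg_eq_0_iff[OF finite_cols]) (auto intro!: sum_nonneg)
  then have "?q a b j = 0"
    using j(1-3) nn by (subst (asm) sum_nonneg_eq_0_iff[OF finite_rows]) auto
  then show ?thesis using j(4,5) by simp
qed

section \<open>Components of the support\<close>

text \<open>Every row has a positive entry and is therefore linked to itself, which makes the
  transitive closure reflexive on \<open>I\<close>.\<close>

lemma equiv_linked: "equiv I (linked\<^sup>+)"
proof (rule equivI)
  have sub: "linked \<subseteq> I \<times> I" by (auto simp: linked_def)
  show "linked\<^sup>+ \<subseteq> I \<times> I" using trancl_subset_Sigma[OF sub] .
  show "refl_on I (linked\<^sup>+)"
    using row_support by (auto simp: refl_on_def linked_def)
  show "sym (linked\<^sup>+)"
    by (rule sym_trancl) (auto simp: sym_def linked_def)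
qed simp

lemma partition_on_cells: "partition_on I cells"
  unfolding cells_def using partition_on_quotient[OF equiv_linked] .

lemma cell_linked:
  assumes "C \<in> cells" and "i \<in> C" and "(i, i') \<in> linked"
  shows "i' \<in> C"
  using assms in_quotient_imp_closed[OF equiv_linked] unfolding cells_def by blast

lemma fixed_vec_cell:
  assumes "fixed_vec f" and "C \<in> cells" and "i \<in> C" and "i' \<in> C"
  shows "f i = f i'"
proof -
  have "(i, i') \<in> linked\<^sup>+"
    using assms in_quotient_imp_in_rel[OF equiv_linked] unfolding cells_def by blast
  then show ?thesis
    by (induction rule: trancl_induct) (auto dest: fixed_vec_linked[OF assms(1)])
qed

text \<open>Two rows positive in a common column are linked, so the positive entries of
  \<open>M\<close> lie in the blocks of \<open>C\<close> and \<open>nbhd C\<close>.\<close>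

lemma support_cell:
  assumes "C \<in> cells" and "i \<in> I" and "j \<in> J" and "0 < M i j"
  shows "i \<in> C \<longleftrightarrow> j \<in> nbhd C"
proof
  assume "j \<in> nbhd C"
  then obtain i' where i': "i' \<in> C" "0 < M i' j" by (auto simp: nbhd_def)
  then have "(i', i) \<in> linked"
    using assms partition_on_cellD(1)[OF finite_rows partition_on_cells assms(1)]
    by (auto simp: linked_def)
  then show "i \<in> C" using cell_linked assms(1) i'(1) by blast
qed (use assms in \<open>auto simp: nbhd_def\<close>)

text \<open>By the block structure, the columns in \<open>nbhd C\<close> carry the whole row of each
  member of \<open>C\<close> and nothing of any other row.\<close>

lemma sum_nbhd:
  assumes C: "C \<in> cells" and "i \<in> I"
  shows "(\<Sum>j\<in>nbhd C. M i j) = (if i \<in> C then row_sum i else 0)"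
proof -
  have zero: "M i j = 0" if "j \<in> J" "\<not> (i \<in> C \<longleftrightarrow> j \<in> nbhd C)" for j
    using support_cell[OF C \<open>i \<in> I\<close> that(1)] nonneg[OF \<open>i \<in> I\<close> that(1)] that(2) by (auto simp: less_le)
  have sub: "nbhd C \<subseteq> J" by (auto simp: nbhd_def)
  show ?thesis
  proof (cases "i \<in> C")
    case True
    then have "(\<Sum>j\<in>nbhd C. M i j) = (\<Sum>j\<in>J. M i j)"
      using zero by (intro sum.mono_neutral_left finite_cols sub) auto
    then show ?thesis using True by (simp add: row_sum_def)
  next
    case False
    then show ?thesis using zero sub by (auto intro!: sum.neutral)
  qed
qed

lemma sum_col_cell:
  assumes C: "C \<in> cells" and "j \<in> J"
  shows "(\<Sum>i\<in>C. M i j * f i) = (if j \<in> nbhd C then \<Sum>i\<in>I. M i j * f i else 0)"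
proof -
  have sub: "C \<subseteq> I" using partition_on_cellD(1)[OF finite_rows partition_on_cells C] .
  have zero: "M i j = 0" if "i \<in> I" "\<not> (i \<in> C \<longleftrightarrow> j \<in> nbhd C)" for i
    using support_cell[OF C that(1) \<open>j \<in> J\<close>] nonneg[OF that(1) \<open>j \<in> J\<close>] that(2) by (auto simp: less_le)
  show ?thesis
  proof (cases "j \<in> nbhd C")
    case True
    then have "(\<Sum>i\<in>C. M i j * f i) = (\<Sum>i\<in>I. M i j * f i)"
      using zero by (intro sum.mono_neutral_left finite_rows sub) auto
    then show ?thesis using True by simp
  next
    case False
    then show ?thesis using zero sub by (auto intro!: sum.neutral)
  qed
qed

section \<open>Row sums, cell sizes and the partition of the columns\<close>

text \<open>By \<open>col_sums\<close>, \<open>M\<^sup>T\<close> sends the row sums to the all-ones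
  vector, which \<open>M\<close> sends back to the row sums.\<close>

lemma fixed_vec_row_sum: "fixed_vec row_sum"
  unfolding fixed_vec_def row_sum_def by (simp add: col_sums)

lemma row_sum_pos: "i \<in> I \<Longrightarrow> 0 < row_sum i"
  unfolding row_sum_def using row_support[of i] nonneg by (auto intro!: sum_pos2 finite_cols)

lemma cell_nonempty: "C \<in> cells \<Longrightarrow> \<exists>i. i \<in> C"
  using partition_onD3[OF partition_on_cells] by (metis ex_in_conv)

text \<open>Column \<open>j\<close> lives on \<open>C\<close>, so the value is \<open>f i\<close>
  times the column sum; taking \<open>row_sum\<close> for \<open>f\<close> gives 1 and so identifies
  the column sum as \<open>1 / row_sum i\<close>.\<close>

lemma col_mult_constant:
  assumes C: "C \<in> cells" and "i \<in> C" and "j \<in> nbhd C"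
    and f: "\<And>i'. i' \<in> C \<Longrightarrow> f i' = f i"
  shows "(\<Sum>i'\<in>I. M i' j * f i') = f i / row_sum i"
proof -
  have jJ: "j \<in> J" using assms(3) by (simp add: nbhd_def)
  have const: "(\<Sum>i'\<in>I. M i' j * g i') = g i * (\<Sum>i'\<in>C. M i' j)"
    if "\<And>i'. i' \<in> C \<Longrightarrow> g i' = g i" for g
  proof -
    have "(\<Sum>i'\<in>I. M i' j * g i') = (\<Sum>i'\<in>C. M i' j * g i')"
      using sum_col_cell[OF C jJ, of g] assms(3) by simp
    also have "\<dots> = (\<Sum>i'\<in>C. M i' j * g i)" using that by simp
    finally show ?thesis by (simp add: sum_distrib_left mult.commute)
  qed
  have "1 = row_sum i * (\<Sum>i'\<in>C. M i' j)"
    using const[of row_sum] fixed_vec_cell[OF fixed_vec_row_sum C _ assms(2)] col_sums[OF jJ]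
    by (simp add: row_sum_def)
  moreover have "row_sum i \<noteq> 0"
    using row_sum_pos partition_on_cellD(1)[OF finite_rows partition_on_cells C] assms(2) by force
  ultimately show ?thesis using const[of f] f by (simp add: field_simps)
qed

lemma col_sum_cell:
  assumes "C \<in> cells" and "i \<in> C" and "j \<in> J"
  shows "(\<Sum>i'\<in>C. M i' j) = (if j \<in> nbhd C then 1 / row_sum i else 0)"
  using sum_col_cell[OF assms(1,3), of "\<lambda>_. 1"] col_mult_constant[OF assms(1,2), of j "\<lambda>_. 1"]
  by simp

text \<open>The total of the block of \<open>C\<close> and \<open>nbhd C\<close> is computed by rows
  and by columns.\<close>

lemma card_nbhd:
  assumes C: "C \<in> cells" and "i \<in> C"
  shows "real (card (nbhd C)) = (row_sum i)\<^sup>2 * card C"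
proof -
  have sub: "C \<subseteq> I" "nbhd C \<subseteq> J"
    using partition_on_cellD(1)[OF finite_rows partition_on_cells C] by (auto simp: nbhd_def)
  have "card C * row_sum i = (\<Sum>i'\<in>C. row_sum i)" by simp
  also have "\<dots> = (\<Sum>i'\<in>C. \<Sum>j\<in>nbhd C. M i' j)"
    using sub fixed_vec_cell[OF fixed_vec_row_sum C assms(2)]
    by (intro sum.cong) (auto simp: sum_nbhd[OF C])
  also have "\<dots> = (\<Sum>j\<in>nbhd C. \<Sum>i'\<in>C. M i' j)" by (rule sum.swap)
  also have "\<dots> = card (nbhd C) / row_sum i"
    using sub by (simp add: col_sum_cell[OF assms] subset_iff)
  finally show ?thesis
    using row_sum_pos[of i] sub assms(2) by (auto simp: field_simps power2_eq_square)
qed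

lemma nbhd_inj:
  assumes "C \<in> cells" and "D \<in> cells" and "j \<in> nbhd C" and "j \<in> nbhd D"
  shows "C = D"
proof -
  obtain i where i: "i \<in> C" "0 < M i j" "j \<in> J" using assms(3) by (auto simp: nbhd_def)
  then have "i \<in> D"
    using support_cell[OF assms(2)] assms(4)
      partition_on_cellD(1)[OF finite_rows partition_on_cells assms(1)] by blast
  then show ?thesis using partition_on_cell_unique[OF partition_on_cells assms(1,2) i(1)] by blast
qed

lemma nbhd_nonempty: "C \<in> cells \<Longrightarrow> \<exists>j. j \<in> nbhd C"
  using cell_nonempty row_support partition_on_cellD(1)[OF finite_rows partition_on_cells]
  by (fastforce simp: nbhd_def)

lemma bij_betw_nbhd: "bij_betw nbhd cells (nbhd ` cells)"
  unfolding bij_betw_def inj_on_def using nbhd_inj nbhd_nonempty by blast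

lemma partition_on_nbhds: "partition_on J (nbhd ` cells)"
proof (rule partition_onI)
  show "\<Union> (nbhd ` cells) = J"
  proof
    show "J \<subseteq> \<Union> (nbhd ` cells)"
    proof
      fix j assume j: "j \<in> J"
      then obtain i where i: "i \<in> I" "0 < M i j" using col_support by blast
      then obtain C where "C \<in> cells" "i \<in> C" using partition_onD1[OF partition_on_cells] by blast
      then show "j \<in> \<Union> (nbhd ` cells)" using i j by (auto simp: nbhd_def)
    qed
  qed (auto simp: nbhd_def)
  show "disjnt p q" if "p \<in> nbhd ` cells" "q \<in> nbhd ` cells" "p \<noteq> q" for p q
    using that nbhd_inj unfolding disjnt_def by blast
  show "{} \<notin> nbhd ` cells"
    using nbhd_nonempty by fastforce
qed

text \<open>With \<open>r\<close> the common row sum on \<open>C\<close>, \<open>M\<^sup>T\<close>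
  sends the indicator of \<open>C\<close> to \<open>1 / r\<close> times that of
  \<open>nbhd C\<close>, and \<open>M\<close> sends the indicator of \<open>nbhd C\<close> to
  \<open>r\<close> times that of \<open>C\<close>.\<close>

lemma fixed_vec_indicator:
  assumes C: "C \<in> cells" and i: "i \<in> I"
  shows "(\<Sum>j\<in>J. M i j * (\<Sum>i'\<in>C. M i' j)) = (if i \<in> C then 1 else 0)"
proof -
  obtain c where c: "c \<in> C" using cell_nonempty[OF C] by blast
  have sub: "nbhd C \<subseteq> J" by (auto simp: nbhd_def)
  have cI: "c \<in> I" using c partition_on_cellD(1)[OF finite_rows partition_on_cells C] by blast
  have "(\<Sum>j\<in>J. M i j * (\<Sum>i'\<in>C. M i' j)) = (\<Sum>j\<in>J. if j \<in> nbhd C then M i j / row_sum c else 0)"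
    by (rule sum.cong) (auto simp: col_sum_cell[OF C c])
  also have "\<dots> = (\<Sum>j\<in>nbhd C. M i j / row_sum c)"
    using finite_cols sub by (simp add: sum.inter_restrict[symmetric] Int_absorb1)
  also have "\<dots> = (if i \<in> C then row_sum i / row_sum c else 0)"
    using sum_nbhd[OF C i] by (simp add: sum_divide_distrib[symmetric])
  finally show ?thesis
    using fixed_vec_cell[OF fixed_vec_row_sum C _ c] row_sum_pos[OF cI] by auto
qed

end

section \<open>From the matrix to isomorphic quotients\<close>

lemma quotient_iso_of_matrix:
  fixes G :: "'a pair_pre_digraph" and H :: "'b pair_pre_digraph"
  assumes G: "pair_graph G" and H: "pair_graph H"
    and nn: "nonneg_mat_on (pverts G) (pverts H) M"
    and dsG: "doubly_stochastic_on (pverts G) (mmult (pverts H) M (mtranspose M))"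
    and dsH: "doubly_stochastic_on (pverts H) (mmult (pverts G) (mtranspose M) M)"
    and comm: "mat_eq_on (pverts G) (pverts H)
      (mmult (pverts G) (adj_mat G) M) (mmult (pverts H) M (adj_mat H))"
  shows "\<exists>\<pi> \<sigma>. equitable_partition G \<pi> \<and> equitable_partition H \<sigma> \<and>
    weighted_iso \<pi> (sym_quotient G \<pi>) \<sigma> (sym_quotient H \<sigma>)"
proof -
  let ?V = "pverts G" and ?W = "pverts H"
  let ?A = "adj_mat G" and ?B = "adj_mat H"
  have V: "finite ?V" and W: "finite ?W"
    using G H by (auto simp: pair_graph_def pair_digraph_def pair_fin_digraph.pair_finite_verts)
  interpret bistochastic_gram ?V ?W M
  proof
    show "(\<Sum>j\<in>?W. M i j * (\<Sum>i'\<in>?V. M i' j)) = 1" if "i \<in> ?V" for i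
      using dsG that unfolding doubly_stochastic_on_mmult_mtranspose_iff[OF nn] by blast
    show "(\<Sum>i\<in>?V. M i j * (\<Sum>j'\<in>?W. M i j')) = 1" if "j \<in> ?W" for j
      using dsH that unfolding doubly_stochastic_on_mtranspose_mmult_iff[OF nn] by blast
  qed (use V W nn in \<open>auto simp: nonneg_mat_on_def\<close>)
  let ?\<sigma> = "nbhd ` cells"
  note cell = partition_on_cellD[OF V partition_on_cells]
  have nbhd_sub: "nbhd C \<subseteq> ?W" for C by (auto simp: nbhd_def)
  \<comment> \<open>These are the images of cell indicators under \<open>A\<close> and
    \<open>B\<close>; equitability says that they are constant on cells.\<close>
  define a where "a C u = (\<Sum>w\<in>C. ?A u w)" for C u
  define b where "b D v = (\<Sum>w\<in>D. ?B v w)" for D v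
  have AM: "(\<Sum>w\<in>?V. ?A u w * M w v) = (\<Sum>w\<in>?W. M u w * ?B w v)" if "u \<in> ?V" "v \<in> ?W" for u v
    using comm that by (simp add: mat_eq_on_def mmult_def)
  \<comment> \<open>Symmetry of \<open>A\<close> and \<open>B\<close> turns \<open>AM = MB\<close>
    into \<open>M\<^sup>T A = B M\<^sup>T\<close>, applied here to the indicator of
    \<open>C\<close>.\<close>
  have MtA: "(\<Sum>u\<in>?V. M u v * a C u) = b (nbhd C) v / row_sum c"
    if C: "C \<in> cells" "c \<in> C" and v: "v \<in> ?W" for C c v
  proof -
    have "(\<Sum>u\<in>?V. M u v * a C u) = (\<Sum>w\<in>C. \<Sum>u\<in>?V. ?A w u * M u v)"
      unfolding a_def by (subst sum.swap)
        (simp add: sum_distrib_left adj_mat_commute[OF G] mult.commute)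
    also have "\<dots> = (\<Sum>w\<in>C. \<Sum>x\<in>?W. M w x * ?B x v)"
      using AM v cell(1)[OF C(1)] by (intro sum.cong) auto
    also have "\<dots> = (\<Sum>x\<in>?W. (\<Sum>w\<in>C. M w x) * ?B x v)"
      by (subst sum.swap) (simp add: sum_distrib_right)
    also have "\<dots> = (\<Sum>x\<in>?W. if x \<in> nbhd C then ?B v x / row_sum c else 0)"
      by (rule sum.cong) (auto simp: col_sum_cell[OF C] adj_mat_commute[OF H])
    also have "\<dots> = b (nbhd C) v / row_sum c"
      using W nbhd_sub by (simp add: sum.inter_restrict[symmetric] Int_absorb1 b_def sum_divide_distrib)
    finally show ?thesis .
  qed
  \<comment> \<open>With \<open>x\<close> the indicator of \<open>C\<close>:
    \<open>M M\<^sup>T A x = M B M\<^sup>T x = A M M\<^sup>T x = A x\<close>.\<close>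
  have a_fixed: "fixed_vec (a C)" if C: "C \<in> cells" for C
    unfolding fixed_vec_def
  proof
    fix u assume u: "u \<in> ?V"
    obtain c where c: "c \<in> C" using cell_nonempty[OF C] by blast
    have "(\<Sum>v\<in>?W. M u v * (\<Sum>u'\<in>?V. M u' v * a C u'))
        = (\<Sum>v\<in>?W. M u v * (b (nbhd C) v / row_sum c))"
      by (simp add: MtA[OF C c])
    also have "\<dots> = (\<Sum>v\<in>?W. \<Sum>w\<in>?W. M u v * ?B v w * (\<Sum>u'\<in>C. M u' w))"
    proof (rule sum.cong)
      fix v
      have "(\<Sum>w\<in>?W. ?B v w * (\<Sum>u'\<in>C. M u' w)) = (\<Sum>w\<in>?W. if w \<in> nbhd C then ?B v w / row_sum c else 0)"
        by (rule sum.cong) (auto simp: col_sum_cell[OF C c])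
      also have "\<dots> = b (nbhd C) v / row_sum c"
        using W nbhd_sub by (simp add: sum.inter_restrict[symmetric] Int_absorb1 b_def sum_divide_distrib)
      finally have "b (nbhd C) v / row_sum c = (\<Sum>w\<in>?W. ?B v w * (\<Sum>u'\<in>C. M u' w))"
        by (rule sym)
      then show "M u v * (b (nbhd C) v / row_sum c) = (\<Sum>w\<in>?W. M u v * ?B v w * (\<Sum>u'\<in>C. M u' w))"
        by (simp only: sum_distrib_left mult.assoc)
    qed simp
    also have "\<dots> = (\<Sum>w\<in>?W. (\<Sum>v\<in>?W. M u v * ?B v w) * (\<Sum>u'\<in>C. M u' w))"
      by (subst sum.swap) (simp add: sum_distrib_right)
    also have "\<dots> = (\<Sum>w\<in>?W. (\<Sum>x\<in>?V. ?A u x * M x w) * (\<Sum>u'\<in>C. M u' w))"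
      using AM u by simp
    also have "\<dots> = (\<Sum>w\<in>?W. \<Sum>x\<in>?V. ?A u x * (M x w * (\<Sum>u'\<in>C. M u' w)))"
      by (simp add: sum_distrib_right mult.assoc)
    also have "\<dots> = (\<Sum>x\<in>?V. ?A u x * (\<Sum>w\<in>?W. M x w * (\<Sum>u'\<in>C. M u' w)))"
      by (subst sum.swap) (simp add: sum_distrib_left)
    also have "\<dots> = (\<Sum>x\<in>?V. if x \<in> C then ?A u x else 0)"
      by (rule sum.cong) (auto simp: fixed_vec_indicator[OF C])
    also have "\<dots> = a C u"
      using V cell(1)[OF C] by (simp add: sum.inter_restrict[symmetric] Int_absorb1 a_def)
    finally show "(\<Sum>v\<in>?W. M u v * (\<Sum>u'\<in>?V. M u' v * a C u')) = a C u" .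
  qed
  \<comment> \<open>\<open>M\<^sup>T (a D)\<close> at \<open>v\<close> is evaluated twice: by
    \<open>MtA\<close>, and by constancy of the fixed vector \<open>a D\<close> on
    \<open>C\<close>.\<close>
  have b_eq: "b (nbhd D) v = row_sum d / row_sum c * a D c"
    if C: "C \<in> cells" "c \<in> C" and D: "D \<in> cells" "d \<in> D" and v: "v \<in> nbhd C" for C D c d v
  proof -
    have "b (nbhd D) v / row_sum d = (\<Sum>u\<in>?V. M u v * a D u)"
      using MtA[OF D] v nbhd_sub by fastforce
    also have "\<dots> = a D c / row_sum c"
      using col_mult_constant[OF C v] fixed_vec_cell[OF a_fixed[OF D(1)] C(1) _ C(2)] by blast
    finally show ?thesis
      using row_sum_pos[of d] cell(1)[OF D(1)] D(2) by (auto simp: field_simps)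
  qed
  have pi: "equitable_partition G cells"
    unfolding equitable_partition_iff_sum[OF G] a_def[symmetric]
    using partition_on_cells fixed_vec_cell a_fixed by blast
  \<comment> \<open>The right side of \<open>b_eq\<close> is independent of \<open>v\<close> in
    \<open>nbhd C\<close>, which gives equitability in \<open>H\<close>.\<close>
  have sigma: "equitable_partition H ?\<sigma>"
    unfolding equitable_partition_iff_sum[OF H] b_def[symmetric]
  proof (intro conjI ballI partition_on_nbhds)
    fix X Y u v assume "X \<in> ?\<sigma>" "Y \<in> ?\<sigma>" "u \<in> X" "v \<in> X"
    then obtain C D c d where "C \<in> cells" "c \<in> C" "D \<in> cells" "d \<in> D"
      "X = nbhd C" "Y = nbhd D" "u \<in> nbhd C" "v \<in> nbhd C"
      using cell_nonempty by blast
    then show "b Y u = b Y v" using b_eq by metis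
  qed
  have "sym_quotient G cells C D = sym_quotient H ?\<sigma> (nbhd C) (nbhd D)"
    if C: "C \<in> cells" and D: "D \<in> cells" for C D
  proof -
    obtain c d v where c: "c \<in> C" and d: "d \<in> D" and v: "v \<in> nbhd C"
      using cell_nonempty nbhd_nonempty C D by metis
    have pos: "0 < row_sum c" "0 < row_sum d"
      using row_sum_pos cell(1) C D c d by blast+
    have "sym_quotient H ?\<sigma> (nbhd C) (nbhd D) =
        sqrt (card (nbhd C)) / sqrt (card (nbhd D)) * b (nbhd D) v"
      unfolding b_def using sym_quotient_equitable[OF H sigma _ _ v] C D by blast
    \<comment> \<open>By \<open>card_nbhd\<close> the square roots contribute
      \<open>row_sum c / row_sum d\<close>, cancelling the factor from \<open>b_eq\<close>.\<close>
    also have "\<dots> = sqrt (card C) / sqrt (card D) * a D c"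
      unfolding b_eq[OF C c D d v] card_nbhd[OF C c] card_nbhd[OF D d]
      using pos by (simp add: real_sqrt_mult)
    also have "\<dots> = sym_quotient G cells C D"
      unfolding a_def using sym_quotient_equitable[OF G pi C D c] by simp
    finally show ?thesis by simp
  qed
  then have "weighted_iso cells (sym_quotient G cells) ?\<sigma> (sym_quotient H ?\<sigma>)"
    unfolding weighted_iso_def using bij_betw_nbhd by blast
  then show ?thesis using pi sigma by blast
qed

theorem theorem2:
  fixes G :: "'a pair_pre_digraph" and H :: "'b pair_pre_digraph"
  assumes "pair_graph G" and "pair_graph H"
  shows "(\<exists>\<pi> \<sigma>. equitable_partition G \<pi> \<and> equitable_partition H \<sigma> \<and>
            weighted_iso \<pi> (sym_quotient G \<pi>) \<sigma> (sym_quotient H \<sigma>))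
     \<longleftrightarrow> (\<exists>M :: ('a, 'b) rmat.
            nonneg_mat_on (pverts G) (pverts H) M \<and>
            doubly_stochastic_on (pverts G) (mmult (pverts H) M (mtranspose M)) \<and>
            doubly_stochastic_on (pverts H) (mmult (pverts G) (mtranspose M) M) \<and>
            mat_eq_on (pverts G) (pverts H)
              (mmult (pverts G) (adj_mat G) M) (mmult (pverts H) M (adj_mat H)))"
  using matrix_of_quotient_iso[OF assms] quotient_iso_of_matrix[OF assms] by blast

end
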